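(* Let $(M,\varphi,\xi,\eta,g)$ be a 3-dimensional $\mathcal{F}_4$-manifold and let $C$ be a $\varphi$-slant null curve in $M$ with constants $a=\eta(\dot C)$, $b=g(\dot C,\varphi\dot C)$. Let $\mathbf{F}=\{\dot C,N,W\}$ be a general Frenet frame along $C$ having the same orientation as the basis $\{\dot C,\xi,\varphi\dot C\}$ at each point of $C$, and let $\beta$ be the function along $C$ which is the coefficient of $\dot C$ in the expansion of $W$ in the basis $\{\dot C,\xi,\varphi\dot C\}$. Then the functions $h$ and $k_1$ in the general Frenet equations of $C$ with respect to $\mathbf{F}$ are $$h=-\beta\,\frac{\theta(\xi)\sqrt{a^4+b^2}}{2},\qquad k_1=\frac{\theta(\xi)\sqrt{a^4+b^2}}{2}.$$
   Context: A 3-dimensional almost contact B-metric manifold $(M,\varphi,\xi,\eta,g)$ is a smooth 3-manifold with a $(1,1)$-tensor field $\varphi$, a vector field $\xi$, a 1-form $\eta$ and a semi-Riemannian metric $g$ such that $\varphi^2X=-X+\eta(X)\xi$, $\eta(\xi)=1$, and $g(\varphi X,\varphi Y)=-g(X,Y)+\eta(X)\eta(Y)$. Consequently $\eta\circ\varphi=0$, $\varphi\xi=0$, $\eta(X)=g(X,\xi)$, $g(\xi,\xi)=1$, and $g$ has signature $(2,1)$. Let $\nabla$ be the Levi-Civita connection of $g$, $F(X,Y,Z)=g((\nabla_X\varphi)Y,Z)$, and $\theta(X)=g^{ij}F(e_i,e_j,X)$ for a local basis $\{e_i\}$, where $(g^{ij})$ is the inverse of $(g(e_i,e_j))$. $M$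 is an $\mathcal{F}_4$-manifold if $$F(X,Y,Z)=-\tfrac{\theta(\xi)}{2}\{g(\varphi X,\varphi Y)\eta(Z)+g(\varphi X,\varphi Z)\eta(Y)\};$$ then $\nabla_X\xi=\tfrac{\theta(\xi)}{2}\varphi X$. Here $\theta(\xi)$ is a smooth function on $M$, evaluated along $C$. A smooth curve $C(t)$ is null if $g(\dot C,\dot C)=0$ and $\dot C\ne0$ everywhere. It is $\varphi$-slant if $\eta(\dot C)=a$ and $g(\dot C,\varphi\dot C)=b$ with $a,b$ real constants. For a $\varphi$-slant null curve in dimension 3 one has $(a,b)\neq(0,0)$, and $\{\dot C,\xi,\varphi\dot C\}$ is a basis of the tangent space at each point of $C$. A general Frenet frame along a null curve $C$ is a frame $\{\dot C,N,W\}$ of vector fields along $C$ with $g(\dot C,N)=g(W,W)=1$, $g(N,N)=g(N,W)=g(\dot C,W)=0$. The general Frenet equations are $$\nabla_{\dot C}\dot C=h\dot C+k_1W,\quad \nabla_{\dot C}N=-hN+k_2W,\quad \nabla_{\dot C}W=-k_2\dot C-k_1N,$$ with functions $h,k_1,k_2$ along $C$. *)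

theory Defs
  imports "HOL-Analysis.Analysis"
begin

text \<open>The set \<open>S\<close> is always open below, so the total derivative at a point of \<open>S\<close> is the right notion.\<close>

primrec C_k_on :: "nat \<Rightarrow> 'a::euclidean_space set \<Rightarrow> ('a \<Rightarrow> 'b::real_normed_vector) \<Rightarrow> bool" where
  "C_k_on 0 S f \<longleftrightarrow> continuous_on S f"
| "C_k_on (Suc k) S f \<longleftrightarrow>
     (\<forall>x\<in>S. f differentiable (at x)) \<and> (\<forall>v. C_k_on k S (\<lambda>x. frechet_derivative f (at x) v))"

definition smooth_on :: "'a::euclidean_space set \<Rightarrow> ('a \<Rightarrow> 'b::real_normed_vector) \<Rightarrow> bool" where
  "smooth_on S f \<longleftrightarrow> (\<forall>k. C_k_on k S f)"

type_synonym ('m, 'n) chart = "'m set \<times> ('m \<Rightarrow> real ^ 'n)"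

abbreviation cdom :: "('m, 'n::finite) chart \<Rightarrow> 'm set" where "cdom \<equiv> fst"
abbreviation cmap :: "('m, 'n::finite) chart \<Rightarrow> 'm \<Rightarrow> real ^ 'n" where "cmap \<equiv> snd"

definition cran :: "('m, 'n::finite) chart \<Rightarrow> (real ^ 'n) set" where
  "cran c = cmap c ` cdom c"

definition overlap :: "('m, 'n::finite) chart \<Rightarrow> ('m, 'n) chart \<Rightarrow> (real ^ 'n) set" where
  "overlap c d = cmap c ` (cdom c \<inter> cdom d)"

definition trans_map :: "('m, 'n::finite) chart \<Rightarrow> ('m, 'n) chart \<Rightarrow> real ^ 'n \<Rightarrow> real ^ 'n" where
  "trans_map c d = cmap d \<circ> inv_into (cdom c) (cmap c)"

definition trans_deriv :: "('m, 'n::finite) chart \<Rightarrow> ('m, 'n) chart \<Rightarrow> real ^ 'n \<Rightarrow> real ^ 'n \<Rightarrow> real ^ 'n" where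
  "trans_deriv c d u = frechet_derivative (trans_map c d) (at u)"

definition charts_at :: "('m, 'n::finite) chart set \<Rightarrow> 'm \<Rightarrow> ('m, 'n) chart set" where
  "charts_at A p = {c \<in> A. p \<in> cdom c}"

definition is_chart :: "'m topology \<Rightarrow> ('m, 'n::finite) chart \<Rightarrow> bool" where
  "is_chart X c \<longleftrightarrow> openin X (cdom c) \<and> open (cran c) \<and>
     homeomorphic_map (subtopology X (cdom c)) (top_of_set (cran c)) (cmap c)"

definition smooth_manifold :: "'m topology \<Rightarrow> ('m, 'n::finite) chart set \<Rightarrow> bool" where
  "smooth_manifold X A \<longleftrightarrow>
     Hausdorff_space X \<and> second_countable X \<and>
     (\<forall>c\<in>A. is_chart X c) \<and> (\<Union>c\<in>A. cdom c) = topspace X \<and>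
     (\<forall>c\<in>A. \<forall>d\<in>A. smooth_on (overlap c d) (trans_map c d))"

text \<open>
  A tensor field is the family of its local expressions: for every chart \<open>c\<close> of the atlas and
  every \<open>u\<close> in the range of \<open>c\<close>, the value at the point with coordinates \<open>u\<close>, a tangent vector
  being identified with its component vector with respect to the coordinate frame of \<open>c\<close>. The
  local expressions are smooth and related by the derivatives of the transition maps.
\<close>

type_synonym ('m, 'n) vfield = "('m, 'n) chart \<Rightarrow> real ^ 'n \<Rightarrow> real ^ 'n"
type_synonym ('m, 'n) form_field = "('m, 'n) chart \<Rightarrow> real ^ 'n \<Rightarrow> real ^ 'n \<Rightarrow> real"
type_synonym ('m, 'n) endo_field = "('m, 'n) chart \<Rightarrow> real ^ 'n \<Rightarrow> real ^ 'n \<Rightarrow> real ^ 'n"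
type_synonym ('m, 'n) bilin_field = "('m, 'n) chart \<Rightarrow> real ^ 'n \<Rightarrow> real ^ 'n \<Rightarrow> real ^ 'n \<Rightarrow> real"
type_synonym ('m, 'n) conn = "('m, 'n) chart \<Rightarrow> real ^ 'n \<Rightarrow> real ^ 'n \<Rightarrow> real ^ 'n \<Rightarrow> real ^ 'n"

definition vector_field :: "('m, 'n::finite) chart set \<Rightarrow> ('m, 'n) vfield \<Rightarrow> bool" where
  "vector_field A V \<longleftrightarrow>
     (\<forall>c\<in>A. smooth_on (cran c) (V c)) \<and>
     (\<forall>c\<in>A. \<forall>d\<in>A. \<forall>u\<in>overlap c d. V d (trans_map c d u) = trans_deriv c d u (V c u))"

definition one_form :: "('m, 'n::finite) chart set \<Rightarrow> ('m, 'n) form_field \<Rightarrow> bool" where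
  "one_form A \<eta> \<longleftrightarrow>
     (\<forall>c\<in>A. (\<forall>u\<in>cran c. linear (\<eta> c u)) \<and> (\<forall>X. smooth_on (cran c) (\<lambda>u. \<eta> c u X))) \<and>
     (\<forall>c\<in>A. \<forall>d\<in>A. \<forall>u\<in>overlap c d. \<forall>X.
        \<eta> d (trans_map c d u) (trans_deriv c d u X) = \<eta> c u X)"

definition tensor_field_1_1 :: "('m, 'n::finite) chart set \<Rightarrow> ('m, 'n) endo_field \<Rightarrow> bool" where
  "tensor_field_1_1 A \<phi> \<longleftrightarrow>
     (\<forall>c\<in>A. (\<forall>u\<in>cran c. linear (\<phi> c u)) \<and> (\<forall>X. smooth_on (cran c) (\<lambda>u. \<phi> c u X))) \<and>
     (\<forall>c\<in>A. \<forall>d\<in>A. \<forall>u\<in>overlap c d. \<forall>X.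
        \<phi> d (trans_map c d u) (trans_deriv c d u X) = trans_deriv c d u (\<phi> c u X))"

definition tensor_field_0_2 :: "('m, 'n::finite) chart set \<Rightarrow> ('m, 'n) bilin_field \<Rightarrow> bool" where
  "tensor_field_0_2 A g \<longleftrightarrow>
     (\<forall>c\<in>A. (\<forall>u\<in>cran c. bilinear (g c u)) \<and> (\<forall>X Y. smooth_on (cran c) (\<lambda>u. g c u X Y))) \<and>
     (\<forall>c\<in>A. \<forall>d\<in>A. \<forall>u\<in>overlap c d. \<forall>X Y.
        g d (trans_map c d u) (trans_deriv c d u X) (trans_deriv c d u Y) = g c u X Y)"

definition form_index :: "(real ^ 'n::finite \<Rightarrow> real ^ 'n \<Rightarrow> real) \<Rightarrow> nat" where
  "form_index b = Max {dim S | S. subspace S \<and> (\<forall>v\<in>S. v \<noteq> 0 \<longrightarrow> b v v < 0)}"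

definition semi_riemannian_metric :: "('m, 'n::finite) chart set \<Rightarrow> ('m, 'n) bilin_field \<Rightarrow> bool" where
  "semi_riemannian_metric A g \<longleftrightarrow> tensor_field_0_2 A g \<and>
     (\<forall>c\<in>A. \<forall>u\<in>cran c.
        (\<forall>X Y. g c u X Y = g c u Y X) \<and>
        (\<forall>X. (\<forall>Y. g c u X Y = 0) \<longrightarrow> X = 0)) \<and>
     (\<exists>\<nu>. \<forall>c\<in>A. \<forall>u\<in>cran c. form_index (g c u) = \<nu>)"

text \<open>
  A connection is given by its Christoffel maps: \<open>\<Gamma> c u X Y\<close> is the value at \<open>u\<close> of the covariant
  derivative in direction \<open>X\<close> of the local field with constant components \<open>Y\<close>. The transition rule
  below says exactly that covariant derivatives of vector fields are again vector fields.
\<close>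

definition affine_connection :: "('m, 'n::finite) chart set \<Rightarrow> ('m, 'n) conn \<Rightarrow> bool" where
  "affine_connection A \<Gamma> \<longleftrightarrow>
     (\<forall>c\<in>A. (\<forall>u\<in>cran c. bilinear (\<Gamma> c u)) \<and> (\<forall>X Y. smooth_on (cran c) (\<lambda>u. \<Gamma> c u X Y))) \<and>
     (\<forall>c\<in>A. \<forall>d\<in>A. \<forall>u\<in>overlap c d. \<forall>X Y.
        \<Gamma> d (trans_map c d u) (trans_deriv c d u X) (trans_deriv c d u Y) =
        trans_deriv c d u (\<Gamma> c u X Y) - frechet_derivative (\<lambda>w. trans_deriv c d w Y) (at u) X)"

text \<open>\<open>nabla \<Gamma> c X V u\<close> is the covariant derivative at \<open>u\<close>, in direction of the vector \<open>X\<close>, of the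
  local field with components \<open>V\<close> in the chart \<open>c\<close>.\<close>

definition nabla :: "('m, 'n::finite) conn \<Rightarrow> ('m, 'n) chart \<Rightarrow> real ^ 'n \<Rightarrow> (real ^ 'n \<Rightarrow> real ^ 'n) \<Rightarrow>
    real ^ 'n \<Rightarrow> real ^ 'n" where
  "nabla \<Gamma> c X V u = frechet_derivative V (at u) X + \<Gamma> c u X (V u)"

definition lie_bracket :: "(real ^ 'n::finite \<Rightarrow> real ^ 'n) \<Rightarrow> (real ^ 'n \<Rightarrow> real ^ 'n) \<Rightarrow> real ^ 'n \<Rightarrow> real ^ 'n" where
  "lie_bracket V W u = frechet_derivative W (at u) (V u) - frechet_derivative V (at u) (W u)"

definition torsion_free :: "('m, 'n::finite) chart set \<Rightarrow> ('m, 'n) conn \<Rightarrow> bool" where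
  "torsion_free A \<Gamma> \<longleftrightarrow>
     (\<forall>c\<in>A. \<forall>V W. smooth_on (cran c) V \<and> smooth_on (cran c) W \<longrightarrow>
        (\<forall>u\<in>cran c. nabla \<Gamma> c (V u) W u - nabla \<Gamma> c (W u) V u = lie_bracket V W u))"

definition metric_connection :: "('m, 'n::finite) chart set \<Rightarrow> ('m, 'n) bilin_field \<Rightarrow> ('m, 'n) conn \<Rightarrow> bool" where
  "metric_connection A g \<Gamma> \<longleftrightarrow>
     (\<forall>c\<in>A. \<forall>V W. smooth_on (cran c) V \<and> smooth_on (cran c) W \<longrightarrow>
        (\<forall>u\<in>cran c. \<forall>X.
           frechet_derivative (\<lambda>w. g c w (V w) (W w)) (at u) X =
           g c u (nabla \<Gamma> c X V u) (W u) + g c u (V u) (nabla \<Gamma> c X W u)))"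

definition levi_civita_connection :: "('m, 'n::finite) chart set \<Rightarrow> ('m, 'n) bilin_field \<Rightarrow> ('m, 'n) conn \<Rightarrow> bool" where
  "levi_civita_connection A g \<Gamma> \<longleftrightarrow>
     affine_connection A \<Gamma> \<and> torsion_free A \<Gamma> \<and> metric_connection A g \<Gamma>"

definition almost_contact_B_metric_manifold ::
  "'m topology \<Rightarrow> ('m, 'n::finite) chart set \<Rightarrow> ('m, 'n) endo_field \<Rightarrow> ('m, 'n) vfield \<Rightarrow>
   ('m, 'n) form_field \<Rightarrow> ('m, 'n) bilin_field \<Rightarrow> bool" where
  "almost_contact_B_metric_manifold M A \<phi> \<xi> \<eta> g \<longleftrightarrow>
     smooth_manifold M A \<and> tensor_field_1_1 A \<phi> \<and> vector_field A \<xi> \<and> one_form A \<eta> \<and>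
     semi_riemannian_metric A g \<and>
     (\<forall>c\<in>A. \<forall>u\<in>cran c.
        (\<forall>X. \<phi> c u (\<phi> c u X) = - X + \<eta> c u X *\<^sub>R \<xi> c u) \<and>
        \<eta> c u (\<xi> c u) = 1 \<and>
        (\<forall>X Y. g c u (\<phi> c u X) (\<phi> c u Y) = - g c u X Y + \<eta> c u X * \<eta> c u Y))"

text \<open>
  \<open>(\<nabla>\<^sub>X \<phi>) Y = \<nabla>\<^sub>X (\<phi> Y) - \<phi> (\<nabla>\<^sub>X Y)\<close> depends only on the value of \<open>Y\<close> at the point; it is evaluated
  on the local field with constant components \<open>Y\<close>.
\<close>

definition nabla_endo :: "('m, 'n::finite) conn \<Rightarrow> ('m, 'n) endo_field \<Rightarrow> ('m, 'n) chart \<Rightarrow> real ^ 'n \<Rightarrow>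
    real ^ 'n \<Rightarrow> real ^ 'n \<Rightarrow> real ^ 'n" where
  "nabla_endo \<Gamma> \<phi> c u X Y = nabla \<Gamma> c X (\<lambda>w. \<phi> c w Y) u - \<phi> c u (nabla \<Gamma> c X (\<lambda>w. Y) u)"

definition F_tensor :: "('m, 'n::finite) bilin_field \<Rightarrow> ('m, 'n) conn \<Rightarrow> ('m, 'n) endo_field \<Rightarrow>
    ('m, 'n) chart \<Rightarrow> real ^ 'n \<Rightarrow> real ^ 'n \<Rightarrow> real ^ 'n \<Rightarrow> real ^ 'n \<Rightarrow> real" where
  "F_tensor g \<Gamma> \<phi> c u X Y Z = g c u (nabla_endo \<Gamma> \<phi> c u X Y) Z"

definition gram_matrix :: "('m, 'n::finite) bilin_field \<Rightarrow> ('m, 'n) chart \<Rightarrow> real ^ 'n \<Rightarrow> real ^ 'n ^ 'n" where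
  "gram_matrix g c u = (\<chi> i j. g c u (axis i 1) (axis j 1))"

definition theta_form :: "('m, 'n::finite) bilin_field \<Rightarrow> ('m, 'n) conn \<Rightarrow> ('m, 'n) endo_field \<Rightarrow>
    ('m, 'n) form_field" where
  "theta_form g \<Gamma> \<phi> c u X =
     (\<Sum>i\<in>UNIV. \<Sum>j\<in>UNIV.
        matrix_inv (gram_matrix g c u) $ i $ j * F_tensor g \<Gamma> \<phi> c u (axis i 1) (axis j 1) X)"

definition F4_manifold ::
  "'m topology \<Rightarrow> ('m, 3) chart set \<Rightarrow> ('m, 3) endo_field \<Rightarrow> ('m, 3) vfield \<Rightarrow>
   ('m, 3) form_field \<Rightarrow> ('m, 3) bilin_field \<Rightarrow> ('m, 3) conn \<Rightarrow> bool" where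
  "F4_manifold M A \<phi> \<xi> \<eta> g \<Gamma> \<longleftrightarrow>
     almost_contact_B_metric_manifold M A \<phi> \<xi> \<eta> g \<and> levi_civita_connection A g \<Gamma> \<and>
     (\<forall>c\<in>A. \<forall>u\<in>cran c. \<forall>X Y Z.
        F_tensor g \<Gamma> \<phi> c u X Y Z =
        - (theta_form g \<Gamma> \<phi> c u (\<xi> c u) / 2) *
          (g c u (\<phi> c u X) (\<phi> c u Y) * \<eta> c u Z + g c u (\<phi> c u X) (\<phi> c u Z) * \<eta> c u Y))"

definition curve_dom :: "real set \<Rightarrow> (real \<Rightarrow> 'm) \<Rightarrow> ('m, 'n::finite) chart \<Rightarrow> real set" where
  "curve_dom I C c = {t \<in> I. C t \<in> cdom c}"

definition smooth_curve :: "'m topology \<Rightarrow> ('m, 'n::finite) chart set \<Rightarrow> real set \<Rightarrow> (real \<Rightarrow> 'm) \<Rightarrow> bool" where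
  "smooth_curve M A I C \<longleftrightarrow>
     open I \<and> is_interval I \<and> continuous_map (top_of_set I) M C \<and>
     (\<forall>c\<in>A. smooth_on (curve_dom I C c) (\<lambda>t. cmap c (C t)))"

definition velocity :: "(real \<Rightarrow> 'm) \<Rightarrow> ('m, 'n::finite) chart \<Rightarrow> real \<Rightarrow> real ^ 'n" where
  "velocity C c t = vector_derivative (\<lambda>s. cmap c (C s)) (at t)"

text \<open>A vector field along \<open>C\<close> is the family of its component functions in the charts.\<close>

type_synonym ('m, 'n) curve_field = "('m, 'n) chart \<Rightarrow> real \<Rightarrow> real ^ 'n"

definition vector_field_along ::
  "('m, 'n::finite) chart set \<Rightarrow> real set \<Rightarrow> (real \<Rightarrow> 'm) \<Rightarrow> ('m, 'n) curve_field \<Rightarrow> bool" where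
  "vector_field_along A I C V \<longleftrightarrow>
     (\<forall>c\<in>A. smooth_on (curve_dom I C c) (V c)) \<and>
     (\<forall>t\<in>I. \<forall>c\<in>charts_at A (C t). \<forall>d\<in>charts_at A (C t).
        V d t = trans_deriv c d (cmap c (C t)) (V c t))"

definition nabla_along :: "('m, 'n::finite) conn \<Rightarrow> (real \<Rightarrow> 'm) \<Rightarrow> ('m, 'n) curve_field \<Rightarrow> ('m, 'n) curve_field" where
  "nabla_along \<Gamma> C V c t =
     vector_derivative (V c) (at t) + \<Gamma> c (cmap c (C t)) (velocity C c t) (V c t)"

definition null_curve ::
  "'m topology \<Rightarrow> ('m, 'n::finite) chart set \<Rightarrow> ('m, 'n) bilin_field \<Rightarrow> real set \<Rightarrow> (real \<Rightarrow> 'm) \<Rightarrow> bool" where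
  "null_curve M A g I C \<longleftrightarrow> smooth_curve M A I C \<and>
     (\<forall>t\<in>I. \<forall>c\<in>charts_at A (C t).
        g c (cmap c (C t)) (velocity C c t) (velocity C c t) = 0 \<and> velocity C c t \<noteq> 0)"

definition phi_slant ::
  "('m, 'n::finite) chart set \<Rightarrow> ('m, 'n) endo_field \<Rightarrow> ('m, 'n) form_field \<Rightarrow> ('m, 'n) bilin_field \<Rightarrow>
   real set \<Rightarrow> (real \<Rightarrow> 'm) \<Rightarrow> real \<Rightarrow> real \<Rightarrow> bool" where
  "phi_slant A \<phi> \<eta> g I C a b \<longleftrightarrow>
     (\<forall>t\<in>I. \<forall>c\<in>charts_at A (C t).
        \<eta> c (cmap c (C t)) (velocity C c t) = a \<and>
        g c (cmap c (C t)) (velocity C c t) (\<phi> c (cmap c (C t)) (velocity C c t)) = b)"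

text \<open>The defining relations force \<open>C', N, W\<close> to be linearly independent at each point.\<close>

definition general_Frenet_frame ::
  "('m, 3) chart set \<Rightarrow> ('m, 3) bilin_field \<Rightarrow> real set \<Rightarrow> (real \<Rightarrow> 'm) \<Rightarrow>
   ('m, 3) curve_field \<Rightarrow> ('m, 3) curve_field \<Rightarrow> bool" where
  "general_Frenet_frame A g I C N W \<longleftrightarrow>
     vector_field_along A I C N \<and> vector_field_along A I C W \<and>
     (\<forall>t\<in>I. \<forall>c\<in>charts_at A (C t).
        let G = g c (cmap c (C t)); T = velocity C c t in
        G T (N c t) = 1 \<and> G (W c t) (W c t) = 1 \<and>
        G (N c t) (N c t) = 0 \<and> G (N c t) (W c t) = 0 \<and> G T (W c t) = 0)"

definition general_Frenet_equations ::
  "('m, 3) chart set \<Rightarrow> ('m, 3) conn \<Rightarrow> real set \<Rightarrow> (real \<Rightarrow> 'm) \<Rightarrow>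
   ('m, 3) curve_field \<Rightarrow> ('m, 3) curve_field \<Rightarrow>
   (real \<Rightarrow> real) \<Rightarrow> (real \<Rightarrow> real) \<Rightarrow> (real \<Rightarrow> real) \<Rightarrow> bool" where
  "general_Frenet_equations A \<Gamma> I C N W h k1 k2 \<longleftrightarrow>
     (\<forall>t\<in>I. \<forall>c\<in>charts_at A (C t).
        nabla_along \<Gamma> C (velocity C) c t = h t *\<^sub>R velocity C c t + k1 t *\<^sub>R W c t \<and>
        nabla_along \<Gamma> C N c t = - h t *\<^sub>R N c t + k2 t *\<^sub>R W c t \<and>
        nabla_along \<Gamma> C W c t = - k2 t *\<^sub>R velocity C c t - k1 t *\<^sub>R N c t)"

text \<open>Ordered bases are given as the rows of a matrix; \<open>P\<close> is the change-of-basis matrix.\<close>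

definition same_orientation :: "real ^ 'n ^ 'n::finite \<Rightarrow> real ^ 'n ^ 'n \<Rightarrow> bool" where
  "same_orientation B B' \<longleftrightarrow>
     (\<exists>P :: real ^ 'n ^ 'n. det P > 0 \<and> (\<forall>i. B' $ i = (\<Sum>j\<in>UNIV. P $ i $ j *\<^sub>R B $ j)))"

end

theory Submission
  imports Defs
begin

text \<open>
  Differentiating the constants \<open>\<eta>(C')\<close> and \<open>g(C', \<phi> C')\<close> along the curve determines the products
  of \<open>\<nabla>\<^bsub>C'\<^esub> C'\<close> with \<open>\<xi>\<close> and \<open>\<phi> C'\<close>. The Frenet conditions and the orientation force
  \<open>W = \<beta> C' + (- b \<xi> + a \<phi> C') / sqrt (a^4 + b^2)\<close>, so \<open>\<nabla>\<^bsub>C'\<^esub> C' = h C' + k\<^sub>1 W\<close> becomes a regular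
  linear system for \<open>h + \<beta> k\<^sub>1\<close> and \<open>k\<^sub>1\<close>.
\<close>

section \<open>Linear algebra of the structure tensors in a single tangent space\<close>

locale almost_contact_B_metric_form =
  fixes \<phi> :: "'a::real_vector \<Rightarrow> 'a" and \<xi> :: 'a and \<eta> :: "'a \<Rightarrow> real" and G :: "'a \<Rightarrow> 'a \<Rightarrow> real"
  assumes linear_phi: "linear \<phi>"
    and linear_eta: "linear \<eta>"
    and bilinear_G: "bilinear G"
    and G_sym: "G X Y = G Y X"
    and phi_phi: "\<phi> (\<phi> X) = - X + \<eta> X *\<^sub>R \<xi>"
    and eta_xi: "\<eta> \<xi> = 1"
    and G_phi_phi: "G (\<phi> X) (\<phi> Y) = - G X Y + \<eta> X * \<eta> Y"
begin

lemmas G_simps =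
  bilinear_ladd[OF bilinear_G] bilinear_radd[OF bilinear_G]
  bilinear_lmul[OF bilinear_G] bilinear_rmul[OF bilinear_G]
  bilinear_lneg[OF bilinear_G] bilinear_rneg[OF bilinear_G]
  bilinear_lsub[OF bilinear_G] bilinear_rsub[OF bilinear_G]
  bilinear_lzero[OF bilinear_G] bilinear_rzero[OF bilinear_G]

text \<open>Since \<open>\<phi> (\<phi> \<xi>) = 0\<close>, the cube of \<open>\<phi>\<close> also
  kills \<open>\<xi>\<close>, and \<open>phi_phi\<close> at \<open>\<phi> \<xi>\<close> makes
  \<open>\<phi> \<xi>\<close> a multiple of \<open>\<xi>\<close>. Applying \<open>\<phi>\<close>
  once more shows that the factor or \<open>\<phi> \<xi>\<close> itself vanishes.\<close>

lemma phi_xi: "\<phi> \<xi> = 0"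
proof -
  have sq: "\<phi> (\<phi> \<xi>) = 0"
    by (simp add: phi_phi eta_xi)
  have "\<phi> (\<phi> (\<phi> \<xi>)) = 0"
    using sq linear_0[OF linear_phi] by simp
  then have eq: "\<phi> \<xi> = \<eta> (\<phi> \<xi>) *\<^sub>R \<xi>"
    by (simp add: phi_phi[of "\<phi> \<xi>"])
  have "\<phi> (\<phi> \<xi>) = \<eta> (\<phi> \<xi>) *\<^sub>R \<phi> \<xi>"
    by (subst (1) eq) (simp add: linear_cmul[OF linear_phi])
  then show ?thesis
    using sq eq by auto
qed

text \<open>The cube of \<open>\<phi>\<close> is computed in two ways: grouping the inner square
  gives \<open>- \<phi> X\<close>, grouping the outer square adds a multiple of
  \<open>\<xi>\<close>, which must therefore vanish.\<close>

lemma eta_phi: "\<eta> (\<phi> X) = 0"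
proof -
  have "\<phi> (\<phi> (\<phi> X)) = - \<phi> X"
    by (simp add: phi_phi[of X] linear_diff[OF linear_phi]
        linear_cmul[OF linear_phi] phi_xi)
  then have "\<eta> (\<phi> X) *\<^sub>R \<xi> = 0"
    by (simp add: phi_phi[of "\<phi> X"])
  moreover have "\<xi> \<noteq> 0"
    using eta_xi linear_0[OF linear_eta] by auto
  ultimately show ?thesis
    by simp
qed

lemma G_xi: "G X \<xi> = \<eta> X"
  using G_phi_phi[of X \<xi>] by (simp add: phi_xi eta_xi G_simps)

text \<open>This self-adjointness is the mark of a B-metric; for an almost contact metric structure
  \<open>\<phi>\<close> would be skew. It follows by putting \<open>\<phi> Y\<close> for
  \<open>Y\<close> in the compatibility condition.\<close>

lemma G_phi_commute: "G (\<phi> X) Y = G X (\<phi> Y)"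
  using G_phi_phi[of X "\<phi> Y"] by (simp add: phi_phi eta_phi G_simps G_xi)

text \<open>The Gram matrix of \<open>T\<close>, \<open>\<xi>\<close>, \<open>\<phi> T\<close> has
  rows \<open>(0, a, b)\<close>, \<open>(a, 1, 0)\<close>, \<open>(b, 0, a^2)\<close>; its
  determinant is \<open>- (a^4 + b^2)\<close>.\<close>

lemma slant_products:
  assumes "G T T = 0" "\<eta> T = a" "G T (\<phi> T) = b"
  shows "G T (x *\<^sub>R T + y *\<^sub>R \<xi> + z *\<^sub>R \<phi> T) = y * a + z * b"
    and "G (x *\<^sub>R T + y *\<^sub>R \<xi> + z *\<^sub>R \<phi> T) \<xi> = x * a + y"
    and "G (x *\<^sub>R T + y *\<^sub>R \<xi> + z *\<^sub>R \<phi> T) (\<phi> T) = x * b + z * a\<^sup>2"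
proof -
  have "G \<xi> \<xi> = 1" "G (\<phi> T) \<xi> = 0" "G \<xi> (\<phi> T) = 0" "G T \<xi> = a" "G (\<phi> T) (\<phi> T) = a\<^sup>2"
    using assms by (auto simp: G_xi eta_xi eta_phi G_sym[of \<xi>] G_phi_phi power2_eq_square)
  with assms show "G T (x *\<^sub>R T + y *\<^sub>R \<xi> + z *\<^sub>R \<phi> T) = y * a + z * b"
    and "G (x *\<^sub>R T + y *\<^sub>R \<xi> + z *\<^sub>R \<phi> T) \<xi> = x * a + y"
    and "G (x *\<^sub>R T + y *\<^sub>R \<xi> + z *\<^sub>R \<phi> T) (\<phi> T) = x * b + z * a\<^sup>2"
    by (simp_all add: G_simps)
qed

lemma slant_coordinates_zero:
  assumes T: "G T T = 0" "\<eta> T = a" "G T (\<phi> T) = b"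
    and nz: "a ^ 4 + b\<^sup>2 \<noteq> 0"
    and eq: "x *\<^sub>R T + y *\<^sub>R \<xi> + z *\<^sub>R \<phi> T = 0"
  shows "x = 0" "y = 0" "z = 0"
proof -
  note prods = slant_products[OF T, of x y z, unfolded eq G_simps]
  \<comment> \<open>Cramer's rule for \<open>x\<close>: the three factors are, up to sign, the first
    row of the adjugate of the Gram matrix.\<close>
  have "x * (a ^ 4 + b\<^sup>2) = a ^ 3 * (x * a + y) + b * (x * b + z * a\<^sup>2) - a\<^sup>2 * (y * a + z * b)"
    by (simp add: algebra_simps power_numeral_reduce)
  also have "\<dots> = 0"
    by (simp flip: prods)
  finally show x: "x = 0"
    using nz by simp
  then show y: "y = 0"
    using prods(2) by simp
  then show "z = 0"
    using prods x nz by auto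
qed

text \<open>The whole problem at one point. \<open>P\<close> expresses the Frenet frame in the slant
  basis, and \<open>D_xi\<close>, \<open>D_phi\<close> carry all that is known of the acceleration.
  The sign of \<open>det P\<close> selects one of the two unit normals that agree up to multiples of
  \<open>T\<close>.\<close>

lemma slant_Frenet_coefficients:
  fixes P :: "real ^ 3 ^ 3"
  assumes T: "G T T = 0" "\<eta> T = a" "G T (\<phi> T) = b"
    and N: "G T N = 1" and W: "G W W = 1" "G T W = 0"
    and orient: "det P > 0"
      "T = P $ 1 $ 1 *\<^sub>R T + P $ 1 $ 2 *\<^sub>R \<xi> + P $ 1 $ 3 *\<^sub>R \<phi> T"
      "N = P $ 2 $ 1 *\<^sub>R T + P $ 2 $ 2 *\<^sub>R \<xi> + P $ 2 $ 3 *\<^sub>R \<phi> T"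
      "W = P $ 3 $ 1 *\<^sub>R T + P $ 3 $ 2 *\<^sub>R \<xi> + P $ 3 $ 3 *\<^sub>R \<phi> T"
    and W_eq: "W = \<beta> *\<^sub>R T + \<gamma> *\<^sub>R \<xi> + \<delta> *\<^sub>R \<phi> T"
    and D_xi: "G (h *\<^sub>R T + k *\<^sub>R W) \<xi> = - (\<theta> * b / 2)"
    and D_phi: "G (h *\<^sub>R T + k *\<^sub>R W) (\<phi> T) = \<theta> * a ^ 3 / 2"
  shows "h = - \<beta> * (\<theta> * sqrt (a ^ 4 + b\<^sup>2) / 2)" "k = \<theta> * sqrt (a ^ 4 + b\<^sup>2) / 2"
proof -
  note prods = slant_products[OF T]
  have ya: "P $ 2 $ 2 * a + P $ 2 $ 3 * b = 1"
    using N orient(3) prods(1) by metis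
  define q where "q = a ^ 4 + b\<^sup>2"
  \<comment> \<open>If \<open>a\<close> and \<open>b\<close> both vanished, \<open>T\<close> would
    be orthogonal to every combination of \<open>T\<close>, \<open>\<xi>\<close>,
    \<open>\<phi> T\<close>, hence to \<open>N\<close>, against \<open>G T N = 1\<close>.\<close>
  have nz: "q \<noteq> 0"
  proof
    assume "q = 0"
    then have "a ^ 4 = 0 \<and> b\<^sup>2 = 0"
      unfolding q_def by (subst (asm) add_nonneg_eq_0_iff) auto
    then show False
      using ya by simp
  qed
  note zero = slant_coordinates_zero[OF T nz[unfolded q_def]]
  \<comment> \<open>Coordinates are unique, so the first row of \<open>P\<close> is
    \<open>(1, 0, 0)\<close> and \<open>det P\<close> reduces to the minor \<open>s\<close> defined
    below.\<close>
  have "(P $ 1 $ 1 - 1) *\<^sub>R T + P $ 1 $ 2 *\<^sub>R \<xi> + P $ 1 $ 3 *\<^sub>R \<phi> T = 0"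
    using orient(2) by (simp add: algebra_simps)
  from zero[OF this] have row1: "P $ 1 $ 1 = 1" "P $ 1 $ 2 = 0" "P $ 1 $ 3 = 0"
    by auto
  have "(P $ 3 $ 1 - \<beta>) *\<^sub>R T + (P $ 3 $ 2 - \<gamma>) *\<^sub>R \<xi> + (P $ 3 $ 3 - \<delta>) *\<^sub>R \<phi> T = 0"
    using orient(4) W_eq by (simp add: algebra_simps)
  from zero[OF this] have row3: "P $ 3 $ 2 = \<gamma>" "P $ 3 $ 3 = \<delta>"
    by auto
  define y z where "y = P $ 2 $ 2" and "z = P $ 2 $ 3"
  define s where "s = y * \<delta> - z * \<gamma>"
  have s_pos: "s > 0"
    using orient(1) by (simp add: det_3 row1 row3 s_def y_def z_def)
  have yz: "y * a + z * b = 1"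
    using ya by (simp add: y_def z_def)
  have perp: "\<gamma> * a + \<delta> * b = 0"
    using W(2) W_eq prods(1) by metis
  \<comment> \<open>By \<open>perp\<close>, the pair of \<open>\<gamma>\<close> and
    \<open>\<delta>\<close> is proportional to \<open>(- b, a)\<close>; the normalisation
    \<open>yz\<close> identifies the factor as \<open>s\<close>.\<close>
  have \<delta>: "\<delta> = s * a"
  proof -
    have "s * a = \<delta> * (y * a + z * b) - z * (\<gamma> * a + \<delta> * b)"
      by (simp add: s_def algebra_simps)
    then show ?thesis
      by (simp add: yz perp)
  qed
  have \<gamma>: "\<gamma> = - s * b"
  proof -
    have "- s * b = \<gamma> * (y * a + z * b) - y * (\<gamma> * a + \<delta> * b)"
      by (simp add: s_def algebra_simps)
    then show ?thesis
      by (simp add: yz perp)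
  qed
  have W_xi: "G W \<xi> = \<beta> * a + \<gamma>" and W_phi: "G W (\<phi> T) = \<beta> * b + \<delta> * a\<^sup>2"
    using prods(2,3) W_eq by auto
  \<comment> \<open>Only one factor of \<open>G W W\<close> is expanded. The terms in
    \<open>\<beta>\<close> cancel afterwards, so that unit length determines \<open>s\<close> up to
    sign, and \<open>s_pos\<close> settles the sign.\<close>
  have "1 = \<beta> * G W T + \<gamma> * G W \<xi> + \<delta> * G W (\<phi> T)"
    by (subst (1) W(1)[symmetric], subst (2) W_eq) (simp add: G_simps)
  also have "\<dots> = \<gamma> * (\<beta> * a + \<gamma>) + \<delta> * (\<beta> * b + \<delta> * a\<^sup>2)"
    using W(2) by (simp add: G_sym[of W T] W_xi W_phi)
  also have "\<dots> = s\<^sup>2 * q"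
    by (simp add: \<gamma> \<delta> q_def algebra_simps power_numeral_reduce)
  finally have s2: "s\<^sup>2 * q = 1"
    by simp
  define r where "r = sqrt q"
  have q_nonneg: "q \<ge> 0"
    by (simp add: q_def)
  have "(s * r)\<^sup>2 = 1" "s * r \<ge> 0"
    using s2 s_pos q_nonneg by (simp_all add: r_def power_mult_distrib)
  then have sr: "s * r = 1"
    by (simp add: power2_eq_1_iff)
  have "G T \<xi> = a"
    using T(2) by (simp add: G_xi)
  with D_xi D_phi T(3)
  have e1: "h * a + k * (\<beta> * a - s * b) = - (\<theta> * b / 2)"
    and e2: "h * b + k * (\<beta> * b + s * a ^ 3) = \<theta> * a ^ 3 / 2"
    by (simp_all add: G_simps W_xi W_phi \<gamma> \<delta> algebra_simps power_numeral_reduce)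
  \<comment> \<open>\<open>e1\<close> and \<open>e2\<close> are linear in
    \<open>h + k * \<beta>\<close> and \<open>k * s\<close>, with determinant \<open>q\<close>. This
    combination eliminates \<open>k * s\<close>; the next one eliminates
    \<open>h + k * \<beta>\<close>.\<close>
  have "(h + k * \<beta>) * q =
      a ^ 3 * (h * a + k * (\<beta> * a - s * b)) + b * (h * b + k * (\<beta> * b + s * a ^ 3))"
    by (simp add: q_def algebra_simps power_numeral_reduce)
  also have "\<dots> = 0"
    unfolding e1 e2 by simp
  finally have h: "h = - k * \<beta>"
    using nz by simp
  have "k * s * q =
      a * (h * b + k * (\<beta> * b + s * a ^ 3)) - b * (h * a + k * (\<beta> * a - s * b))"
    by (simp add: q_def algebra_simps power_numeral_reduce)
  also have "\<dots> = \<theta> / 2 * q"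
    unfolding e1 e2 by (simp add: q_def algebra_simps power_numeral_reduce)
  finally have "k * s = \<theta> / 2"
    using nz by simp
  then have "k * (s * r) = \<theta> / 2 * r"
    by (metis mult.assoc)
  then have k: "k = \<theta> * r / 2"
    by (simp add: sr)
  show "h = - \<beta> * (\<theta> * sqrt (a ^ 4 + b\<^sup>2) / 2)" "k = \<theta> * sqrt (a ^ 4 + b\<^sup>2) / 2"
    using h k by (simp_all add: r_def q_def)
qed

end

section \<open>Differentiation of tensors and fields along a curve\<close>

lemma smooth_on_imp_differentiable:
  assumes "smooth_on S f" "x \<in> S"
  shows "f differentiable (at x)"
proof -
  have "C_k_on 1 S f"
    using assms(1) unfolding smooth_on_def by blast
  with assms(2) show ?thesis
    by simp
qed

lemma smooth_on_imp_differentiable_derivative: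
  assumes "smooth_on S f" "x \<in> S"
  shows "(\<lambda>y. frechet_derivative f (at y) v) differentiable (at x)"
proof -
  have "C_k_on (Suc (Suc 0)) S f"
    using assms(1) unfolding smooth_on_def by blast
  with assms(2) show ?thesis
    by simp
qed

lemma smooth_on_const: "smooth_on S (\<lambda>x. v)"
proof -
  have "C_k_on k S (\<lambda>x. v)" for k
  proof (induction k arbitrary: v)
    case (Suc k)
    then show ?case by simp
  qed simp
  then show ?thesis
    by (simp add: smooth_on_def)
qed

lemma differentiable_chain_vector_derivative:
  assumes "f differentiable (at (u t))" "(u has_vector_derivative u') (at t)"
  shows "((\<lambda>s. f (u s)) has_vector_derivative frechet_derivative f (at (u t)) u') (at t)"
proof -
  have "(f has_derivative frechet_derivative f (at (u t))) (at (u t) within range u)"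
    using assms(1) by (simp add: frechet_derivative_works has_derivative_at_withinI)
  from vector_derivative_diff_chain_within[OF assms(2) this] show ?thesis
    by (simp add: o_def)
qed

text \<open>In finite dimension, expanding the argument over \<open>Basis\<close> reduces this to
  the product rule for scalar coefficients times the curves \<open>L s e\<close>.\<close>

lemma has_vector_derivative_linear_family:
  fixes L :: "real \<Rightarrow> 'a::euclidean_space \<Rightarrow> 'b::real_normed_vector"
  assumes "open J" "t \<in> J"
    and lin: "\<And>s. s \<in> J \<Longrightarrow> linear (L s)"
    and L': "\<And>X. ((\<lambda>s. L s X) has_vector_derivative D X) (at t)"
    and V': "(V has_vector_derivative V') (at t)"
  shows "((\<lambda>s. L s (V s)) has_vector_derivative D (V t) + L t V') (at t)"
proof -
  have expand: "L s X = (\<Sum>e\<in>Basis. (X \<bullet> e) *\<^sub>R L s e)" if "s \<in> J" for s X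
  proof -
    have "L s X = L s (\<Sum>e\<in>Basis. (X \<bullet> e) *\<^sub>R e)"
      by (simp add: euclidean_representation)
    then show ?thesis
      by (simp add: linear_sum[OF lin[OF that]] linear_cmul[OF lin[OF that]])
  qed
  \<comment> \<open>\<open>D\<close> is given only as a family of derivatives; its linearity comes
    from their uniqueness.\<close>
  have D: "D X = (\<Sum>e\<in>Basis. (X \<bullet> e) *\<^sub>R D e)" for X
  proof (rule vector_derivative_unique_at[OF L'])
    have "((\<lambda>s. \<Sum>e\<in>Basis. (X \<bullet> e) *\<^sub>R L s e) has_vector_derivative
        (\<Sum>e\<in>Basis. (X \<bullet> e) *\<^sub>R D e)) (at t)"
      by (intro has_vector_derivative_sum
          bounded_linear.has_vector_derivative[OF bounded_linear_scaleR_right] L')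
    then show "((\<lambda>s. L s X) has_vector_derivative (\<Sum>e\<in>Basis. (X \<bullet> e) *\<^sub>R D e)) (at t)"
      by (rule has_vector_derivative_transform_within_open[OF _ \<open>open J\<close> \<open>t \<in> J\<close>])
        (simp add: expand)
  qed
  have inner: "((\<lambda>s. V s \<bullet> e) has_field_derivative V' \<bullet> e) (at t)" for e
    using bounded_linear.has_vector_derivative[OF bounded_linear_inner_left V']
    by (simp add: has_real_derivative_iff_has_vector_derivative)
  have "((\<lambda>s. \<Sum>e\<in>Basis. (V s \<bullet> e) *\<^sub>R L s e) has_vector_derivative
      (\<Sum>e\<in>Basis. (V t \<bullet> e) *\<^sub>R D e + (V' \<bullet> e) *\<^sub>R L t e)) (at t)"
    by (intro has_vector_derivative_sum has_vector_derivative_scaleR L' inner)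
  then have "((\<lambda>s. \<Sum>e\<in>Basis. (V s \<bullet> e) *\<^sub>R L s e) has_vector_derivative D (V t) + L t V') (at t)"
    using D[of "V t"] expand[OF \<open>t \<in> J\<close>, of V'] by (simp add: sum.distrib)
  then show ?thesis
    by (rule has_vector_derivative_transform_within_open[OF _ \<open>open J\<close> \<open>t \<in> J\<close>])
      (simp add: expand)
qed

lemma has_vector_derivative_zero_of_const:
  assumes "(f has_vector_derivative f') (at t)" "open J" "t \<in> J" "\<And>s. s \<in> J \<Longrightarrow> f s = k"
  shows "f' = 0"
proof (rule vector_derivative_unique_at[OF assms(1)])
  show "(f has_vector_derivative 0) (at t)"
    by (rule has_vector_derivative_transform_within_open[OF has_vector_derivative_const[of k]])
      (use assms in auto)
qed

text \<open>Metric compatibility is stated for fields on a chart, while a field along a curve need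
  not extend to one. It is therefore used only on constant component fields, which gives the
  derivative of \<open>g\<close> in terms of \<open>\<Gamma>\<close>; bilinearity supplies the
  rest.\<close>

lemma metric_connection_product_rule_along:
  assumes "tensor_field_0_2 A g" "metric_connection A g \<Gamma>" "c \<in> A"
    and J: "open J" "t \<in> J" and ran: "\<And>s. s \<in> J \<Longrightarrow> u s \<in> cran c"
    and u': "(u has_vector_derivative u') (at t)"
    and V': "(V has_vector_derivative V') (at t)"
    and W': "(W has_vector_derivative W') (at t)"
  shows "((\<lambda>s. g c (u s) (V s) (W s)) has_vector_derivative
      g c (u t) (V' + \<Gamma> c (u t) u' (V t)) (W t) + g c (u t) (V t) (W' + \<Gamma> c (u t) u' (W t))) (at t)"
proof -
  have bil: "bilinear (g c (u s))" if "s \<in> J" for s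
    using assms(1,3) ran[OF that] by (auto simp: tensor_field_0_2_def)
  have ut: "u t \<in> cran c"
    by (rule ran[OF J(2)])
  have diff: "(\<lambda>w. g c w X Y) differentiable (at (u t))" for X Y
    using assms(1,3) ut by (intro smooth_on_imp_differentiable[of "cran c"])
      (auto simp: tensor_field_0_2_def)
  define D where "D X Y = frechet_derivative (\<lambda>w. g c w X Y) (at (u t)) u'" for X Y
  have "frechet_derivative (\<lambda>w. g c w X Y) (at (u t)) u' =
      g c (u t) (nabla \<Gamma> c u' (\<lambda>w. X) (u t)) Y + g c (u t) X (nabla \<Gamma> c u' (\<lambda>w. Y) (u t))" for X Y
    using assms(2)[unfolded metric_connection_def, rule_format, OF assms(3), of "\<lambda>w. X" "\<lambda>w. Y"]
      smooth_on_const ut by blast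
  then have D: "D X Y = g c (u t) (\<Gamma> c (u t) u' X) Y + g c (u t) X (\<Gamma> c (u t) u' Y)" for X Y
    by (simp add: D_def nabla_def)
  \<comment> \<open>The rule for linear families is applied twice: first in the second slot with
    \<open>X\<close> fixed, then in the first slot with the moving \<open>W s\<close> absorbed into
    the family.\<close>
  have "((\<lambda>s. g c (u s) X (W s)) has_vector_derivative D X (W t) + g c (u t) X W') (at t)" for X
    using bil differentiable_chain_vector_derivative[OF diff u'] W'
    by (intro has_vector_derivative_linear_family[OF J]) (auto simp: bilinear_def D_def)
  then have "((\<lambda>s. g c (u s) (V s) (W s)) has_vector_derivative
      (D (V t) (W t) + g c (u t) (V t) W') + g c (u t) V' (W t)) (at t)"
    using bil V'
    by (intro has_vector_derivative_linear_family[OF J, where L = "\<lambda>s X. g c (u s) X (W s)"])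
      (auto simp: bilinear_def)
  then show ?thesis
    using bil[OF J(2)] by (simp add: D bilinear_ladd bilinear_radd algebra_simps)
qed

text \<open>Leibniz rule for the covariant derivative of \<open>\<phi> V\<close> along the curve.
  \<open>Z\<close> is the plain derivative of its components; adding the \<open>\<Gamma>\<close>
  term makes it covariant.\<close>

lemma nabla_endo_along:
  assumes "tensor_field_1_1 A \<phi>" "c \<in> A"
    and J: "open J" "t \<in> J" and ran: "\<And>s. s \<in> J \<Longrightarrow> u s \<in> cran c"
    and u': "(u has_vector_derivative u') (at t)"
    and V': "(V has_vector_derivative V') (at t)"
  obtains Z where "((\<lambda>s. \<phi> c (u s) (V s)) has_vector_derivative Z) (at t)"
    and "Z + \<Gamma> c (u t) u' (\<phi> c (u t) (V t)) =
      nabla_endo \<Gamma> \<phi> c (u t) u' (V t) + \<phi> c (u t) (V' + \<Gamma> c (u t) u' (V t))"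
proof
  have lin: "linear (\<phi> c (u s))" if "s \<in> J" for s
    using assms(1,2) ran[OF that] by (auto simp: tensor_field_1_1_def)
  have diff: "(\<lambda>w. \<phi> c w X) differentiable (at (u t))" for X
    using assms(1,2) ran[OF J(2)] by (intro smooth_on_imp_differentiable[of "cran c"])
      (auto simp: tensor_field_1_1_def)
  show "((\<lambda>s. \<phi> c (u s) (V s)) has_vector_derivative
      frechet_derivative (\<lambda>w. \<phi> c w (V t)) (at (u t)) u' + \<phi> c (u t) V') (at t)"
    by (rule has_vector_derivative_linear_family[OF J lin
          differentiable_chain_vector_derivative[OF diff u'] V'])
  show "(frechet_derivative (\<lambda>w. \<phi> c w (V t)) (at (u t)) u' + \<phi> c (u t) V') +
      \<Gamma> c (u t) u' (\<phi> c (u t) (V t)) =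
      nabla_endo \<Gamma> \<phi> c (u t) u' (V t) + \<phi> c (u t) (V' + \<Gamma> c (u t) u' (V t))"
    using lin[OF J(2)] by (simp add: nabla_endo_def nabla_def linear_add)
qed

section \<open>Structure and curve in a chart, and the acceleration of a slant null curve\<close>

lemma almost_contact_B_metric_form_at:
  assumes "almost_contact_B_metric_manifold M A \<phi> \<xi> \<eta> g" "c \<in> A" "u \<in> cran c"
  shows "almost_contact_B_metric_form (\<phi> c u) (\<xi> c u) (\<eta> c u) (g c u)"
proof (rule almost_contact_B_metric_form.intro)
  note M = assms(1)[unfolded almost_contact_B_metric_manifold_def]
  have "tensor_field_1_1 A \<phi>" "one_form A \<eta>" "semi_riemannian_metric A g"
    using M by blast+
  then show "linear (\<phi> c u)" "linear (\<eta> c u)" "bilinear (g c u)" "g c u X Y = g c u Y X" for X Y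
    using assms(2,3)
    by (simp_all add: tensor_field_1_1_def one_form_def semi_riemannian_metric_def tensor_field_0_2_def)
  show "\<phi> c u (\<phi> c u X) = - X + \<eta> c u X *\<^sub>R \<xi> c u" "\<eta> c u (\<xi> c u) = 1"
    "g c u (\<phi> c u X) (\<phi> c u Y) = - g c u X Y + \<eta> c u X * \<eta> c u Y" for X Y
    using M assms(2,3) by blast+
qed

text \<open>Makes the parameters seen by one chart a neighbourhood of each of them, so that
  identities holding there can be differentiated.\<close>

lemma open_curve_dom:
  assumes "smooth_curve M A I C" "is_chart M c"
  shows "open (curve_dom I C c)"
proof -
  have "openin (top_of_set I) {t \<in> topspace (top_of_set I). C t \<in> cdom c}"
    using assms by (intro openin_continuous_map_preimage) (auto simp: smooth_curve_def is_chart_def)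
  moreover have "open I"
    using assms(1) by (simp add: smooth_curve_def)
  ultimately show ?thesis
    by (simp add: curve_dom_def openin_open_eq)
qed

lemma velocity_works:
  assumes "smooth_curve M A I C" "c \<in> A" "t \<in> curve_dom I C c"
  shows "((\<lambda>s. cmap c (C s)) has_vector_derivative velocity C c t) (at t)"
  using assms smooth_on_imp_differentiable[of "curve_dom I C c" "\<lambda>s. cmap c (C s)"]
  unfolding velocity_def by (auto simp: smooth_curve_def vector_derivative_works)

text \<open>Smoothness speaks of iterated Frechet derivatives, so \<open>velocity\<close> is first
  identified, on the open curve domain, with the Frechet derivative in direction
  \<open>1\<close>.\<close>

lemma velocity_differentiable:
  assumes C: "smooth_curve M A I C" and c: "c \<in> A" "is_chart M c" and t: "t \<in> curve_dom I C c"
  shows "(velocity C c has_vector_derivative vector_derivative (velocity C c) (at t)) (at t)"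
proof -
  let ?u = "\<lambda>s. cmap c (C s)"
  have smooth: "smooth_on (curve_dom I C c) ?u"
    using C c(1) by (simp add: smooth_curve_def)
  have "(\<lambda>s. frechet_derivative ?u (at s) 1) differentiable (at t)"
    by (rule smooth_on_imp_differentiable_derivative[OF smooth t])
  then obtain D where "((\<lambda>s. frechet_derivative ?u (at s) 1) has_vector_derivative D) (at t)"
    using vector_derivative_works by blast
  then have "(velocity C c has_vector_derivative D) (at t)"
  proof (rule has_vector_derivative_transform_within_open[OF _ open_curve_dom[OF C c(2)] t])
    fix s assume "s \<in> curve_dom I C c"
    then have "?u differentiable (at s)"
      by (rule smooth_on_imp_differentiable[OF smooth])
    then show "frechet_derivative ?u (at s) 1 = velocity C c s"
      by (simp add: velocity_def frechet_derivative_eq_vector_derivative)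
  qed
  then show ?thesis
    by (simp add: vector_derivative_at)
qed

text \<open>Of the covariant derivative of \<open>\<xi>\<close> along the curve, only its products
  with \<open>\<xi>\<close> and the velocity are used; they are extracted from the constancy of
  \<open>g(\<xi>, \<xi>)\<close> and \<open>\<phi> \<xi>\<close> and from the formula for
  \<open>F\<close>.\<close>

lemma F4_phi_slant_acceleration:
  fixes A :: "('m, 3) chart set"
  assumes F4: "F4_manifold M A \<phi> \<xi> \<eta> g \<Gamma>"
    and null: "null_curve M A g I C"
    and slant: "phi_slant A \<phi> \<eta> g I C a b"
    and t: "t \<in> I" and c: "c \<in> charts_at A (C t)"
  defines "p \<equiv> cmap c (C t)"
  defines "\<theta> \<equiv> theta_form g \<Gamma> \<phi> c p (\<xi> c p)"
  shows "g c p (nabla_along \<Gamma> C (velocity C) c t) (\<xi> c p) = - (\<theta> * b / 2)"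
    and "g c p (nabla_along \<Gamma> C (velocity C) c t) (\<phi> c p (velocity C c t)) = \<theta> * a ^ 3 / 2"
proof -
  define J where "J = curve_dom I C c"
  define u where "u s = cmap c (C s)" for s
  define T where "T = velocity C c"
  define T' where "T' = vector_derivative T (at t)"
  have cA: "c \<in> A" and tJ: "t \<in> J"
    using t c by (auto simp: charts_at_def J_def curve_dom_def)
  have acm: "almost_contact_B_metric_manifold M A \<phi> \<xi> \<eta> g"
    and aff: "affine_connection A \<Gamma>" and met: "metric_connection A g \<Gamma>"
    using F4 by (auto simp: F4_manifold_def levi_civita_connection_def)
  have chart: "is_chart M c" and ten\<phi>: "tensor_field_1_1 A \<phi>" and teng: "tensor_field_0_2 A g"
    and vf\<xi>: "vector_field A \<xi>"
    using acm cA by (auto simp: almost_contact_B_metric_manifold_def smooth_manifold_def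
        semi_riemannian_metric_def)
  have C: "smooth_curve M A I C"
    using null by (simp add: null_curve_def)
  have J: "open J"
    unfolding J_def by (rule open_curve_dom[OF C chart])
  have ran: "u s \<in> cran c" if "s \<in> J" for s
    using that by (auto simp: u_def J_def curve_dom_def cran_def)
  have u': "(u has_vector_derivative T t) (at t)"
    unfolding u_def T_def using velocity_works[OF C cA] tJ by (simp add: J_def)
  have V': "(T has_vector_derivative T') (at t)"
    unfolding T_def T'_def using velocity_differentiable[OF C cA chart] tJ by (simp add: J_def)
  \<comment> \<open>The structure is needed on all of \<open>J\<close>: an identity must hold near
    \<open>t\<close> before it can be differentiated at \<open>t\<close>.\<close>
  have form: "almost_contact_B_metric_form (\<phi> c (u s)) (\<xi> c (u s)) (\<eta> c (u s)) (g c (u s))"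
    if "s \<in> J" for s
    by (rule almost_contact_B_metric_form_at[OF acm cA ran[OF that]])
  interpret almost_contact_B_metric_form "\<phi> c (u t)" "\<xi> c (u t)" "\<eta> c (u t)" "g c (u t)"
    by (rule form[OF tJ])
  have T: "g c (u s) (T s) (T s) = 0" "\<eta> c (u s) (T s) = a" "g c (u s) (T s) (\<phi> c (u s) (T s)) = b"
    if "s \<in> J" for s
  proof -
    have "s \<in> I" "c \<in> charts_at A (C s)"
      using that cA by (auto simp: J_def curve_dom_def charts_at_def)
    then show "g c (u s) (T s) (T s) = 0" "\<eta> c (u s) (T s) = a"
      "g c (u s) (T s) (\<phi> c (u s) (T s)) = b"
      using null slant by (auto simp: null_curve_def phi_slant_def u_def T_def)
  qed
  have pu: "p = u t"
    by (simp add: p_def u_def)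
  have F: "F_tensor g \<Gamma> \<phi> c (u t) X Y Z = - (\<theta> / 2) *
      (g c (u t) (\<phi> c (u t) X) (\<phi> c (u t) Y) * \<eta> c (u t) Z +
       g c (u t) (\<phi> c (u t) X) (\<phi> c (u t) Z) * \<eta> c (u t) Y)" for X Y Z
    using F4 cA ran[OF tJ] unfolding F4_manifold_def \<theta>_def pu by blast
  note product_rule = metric_connection_product_rule_along[where u = u, OF teng met cA J tJ ran u']
  define \<xi>' where "\<xi>' = frechet_derivative (\<xi> c) (at (u t)) (T t)"
  have \<xi>': "((\<lambda>s. \<xi> c (u s)) has_vector_derivative \<xi>') (at t)"
    unfolding \<xi>'_def
  proof (rule differentiable_chain_vector_derivative[OF _ u'])
    show "\<xi> c differentiable (at (u t))"
      using vf\<xi> cA ran[OF tJ] by (auto simp: vector_field_def intro: smooth_on_imp_differentiable)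
  qed
  define Dxi where "Dxi = \<xi>' + \<Gamma> c (u t) (T t) (\<xi> c (u t))"
  define DT where "DT = T' + \<Gamma> c (u t) (T t) (T t)"
  have DT: "nabla_along \<Gamma> C (velocity C) c t = DT"
    by (simp add: DT_def T'_def nabla_along_def T_def u_def)

  have "g c (u t) Dxi (\<xi> c (u t)) + g c (u t) (\<xi> c (u t)) Dxi = 0"
    unfolding Dxi_def
  proof (rule has_vector_derivative_zero_of_const[OF product_rule[OF _ \<xi>' \<xi>'] J tJ])
    fix s assume "s \<in> J"
    then interpret s: almost_contact_B_metric_form "\<phi> c (u s)" "\<xi> c (u s)" "\<eta> c (u s)" "g c (u s)"
      by (rule form)
    show "g c (u s) (\<xi> c (u s)) (\<xi> c (u s)) = 1"
      by (simp add: s.G_xi s.eta_xi)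
  qed
  then have eta_Dxi: "\<eta> c (u t) Dxi = 0"
    by (simp add: G_sym[of "\<xi> c (u t)"] G_xi)

  \<comment> \<open>Differentiating \<open>\<phi> \<xi> = 0\<close> turns the derivative of
    \<open>\<phi>\<close> applied to \<open>\<xi>\<close> into \<open>- \<phi> Dxi\<close>.\<close>
  obtain Z where Z: "((\<lambda>s. \<phi> c (u s) (\<xi> c (u s))) has_vector_derivative Z) (at t)"
    "Z + \<Gamma> c (u t) (T t) (\<phi> c (u t) (\<xi> c (u t))) =
      nabla_endo \<Gamma> \<phi> c (u t) (T t) (\<xi> c (u t)) + \<phi> c (u t) Dxi"
    unfolding Dxi_def by (rule nabla_endo_along[where u = u, OF ten\<phi> cA J tJ ran u' \<xi>'])
  have "Z = 0"
  proof (rule has_vector_derivative_zero_of_const[OF Z(1) J tJ])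
    fix s assume "s \<in> J"
    then show "\<phi> c (u s) (\<xi> c (u s)) = 0"
      by (rule almost_contact_B_metric_form.phi_xi[OF form])
  qed
  moreover have "\<Gamma> c (u t) (T t) 0 = 0"
    using aff cA ran[OF tJ] by (auto simp: affine_connection_def intro: bilinear_rzero)
  ultimately have nabla_xi: "nabla_endo \<Gamma> \<phi> c (u t) (T t) (\<xi> c (u t)) = - \<phi> c (u t) Dxi"
    using Z(2) by (simp add: phi_xi eq_neg_iff_add_eq_0)
  \<comment> \<open>Pairing with \<open>\<phi> T\<close> brings in compatibility; its
    \<open>\<eta>\<close> term drops out by \<open>eta_Dxi\<close>.\<close>
  have "g c (u t) Dxi (T t) = F_tensor g \<Gamma> \<phi> c (u t) (T t) (\<xi> c (u t)) (\<phi> c (u t) (T t))"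
    by (simp add: F_tensor_def nabla_xi G_simps G_phi_phi eta_Dxi)
  also have "\<dots> = \<theta> * b / 2"
    using T(3)[OF tJ]
    by (simp add: F phi_xi eta_xi eta_phi phi_phi G_simps G_xi G_sym[of "\<phi> c (u t) (T t)" "T t"])
  finally have Dxi_T: "g c (u t) Dxi (T t) = \<theta> * b / 2" .

  \<comment> \<open>This differentiates the constant \<open>a\<close>, rewritten as
    \<open>g(T, \<xi>)\<close>.\<close>
  have "g c (u t) DT (\<xi> c (u t)) + g c (u t) (T t) Dxi = 0"
    unfolding Dxi_def DT_def
  proof (rule has_vector_derivative_zero_of_const[OF product_rule[OF _ V' \<xi>'] J tJ])
    fix s assume "s \<in> J"
    then show "g c (u s) (T s) (\<xi> c (u s)) = a"
      using almost_contact_B_metric_form.G_xi[OF form] T(2) by metis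
  qed
  then show "g c p (nabla_along \<Gamma> C (velocity C) c t) (\<xi> c p) = - (\<theta> * b / 2)"
    using Dxi_T G_sym[of Dxi "T t"] by (simp add: DT pu)

  obtain Y where Y: "((\<lambda>s. \<phi> c (u s) (T s)) has_vector_derivative Y) (at t)"
    "Y + \<Gamma> c (u t) (T t) (\<phi> c (u t) (T t)) =
      nabla_endo \<Gamma> \<phi> c (u t) (T t) (T t) + \<phi> c (u t) DT"
    unfolding DT_def by (rule nabla_endo_along[where u = u, OF ten\<phi> cA J tJ ran u' V'])
  have "g c (u t) DT (\<phi> c (u t) (T t)) +
      g c (u t) (T t) (Y + \<Gamma> c (u t) (T t) (\<phi> c (u t) (T t))) = 0"
    unfolding DT_def
    by (rule has_vector_derivative_zero_of_const[OF product_rule[OF _ V' Y(1)] J tJ T(3)])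
  \<comment> \<open>Self-adjointness of \<open>\<phi>\<close> merges both terms containing
    \<open>DT\<close>, whence the factor 2.\<close>
  then have "2 * g c (u t) DT (\<phi> c (u t) (T t)) + F_tensor g \<Gamma> \<phi> c (u t) (T t) (T t) (T t) = 0"
    using G_sym[of "T t"] G_phi_commute[of DT "T t"] by (simp add: Y(2) G_simps F_tensor_def)
  \<comment> \<open>Both summands of the defining formula coincide here, and nullity of
    \<open>T\<close> gives \<open>g(\<phi> T, \<phi> T) = a^2\<close>.\<close>
  moreover have "F_tensor g \<Gamma> \<phi> c (u t) (T t) (T t) (T t) = - (\<theta> * a ^ 3)"
    using T(1,2)[OF tJ] by (simp add: F G_phi_phi power3_eq_cube)
  ultimately show "g c p (nabla_along \<Gamma> C (velocity C) c t) (\<phi> c p (velocity C c t)) = \<theta> * a ^ 3 / 2"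
    by (simp add: DT pu T_def)
qed

section \<open>The Frenet functions in an arbitrary chart at a point of the curve\<close>

theorem proposition3p5:
  fixes M :: "'m topology" and A :: "('m, 3) chart set"
    and \<phi> :: "('m, 3) endo_field" and \<xi> :: "('m, 3) vfield"
    and \<eta> :: "('m, 3) form_field" and g :: "('m, 3) bilin_field" and \<Gamma> :: "('m, 3) conn"
    and I :: "real set" and C :: "real \<Rightarrow> 'm" and a b :: real
    and N W :: "('m, 3) curve_field" and \<beta> h k1 k2 :: "real \<Rightarrow> real"
  assumes "F4_manifold M A \<phi> \<xi> \<eta> g \<Gamma>"
    and "null_curve M A g I C"
    and "phi_slant A \<phi> \<eta> g I C a b"
    and "general_Frenet_frame A g I C N W"
    and "\<forall>t\<in>I. \<forall>c\<in>charts_at A (C t).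
           same_orientation
             (vector [velocity C c t, \<xi> c (cmap c (C t)), \<phi> c (cmap c (C t)) (velocity C c t)])
             (vector [velocity C c t, N c t, W c t])"
    and "\<forall>t\<in>I. \<forall>c\<in>charts_at A (C t). \<exists>\<gamma> \<delta>.
           W c t = \<beta> t *\<^sub>R velocity C c t + \<gamma> *\<^sub>R \<xi> c (cmap c (C t))
                   + \<delta> *\<^sub>R \<phi> c (cmap c (C t)) (velocity C c t)"
    and "general_Frenet_equations A \<Gamma> I C N W h k1 k2"
  shows "\<forall>t\<in>I. \<forall>c\<in>charts_at A (C t).
           h t = - \<beta> t * (theta_form g \<Gamma> \<phi> c (cmap c (C t)) (\<xi> c (cmap c (C t))) * sqrt (a ^ 4 + b ^ 2) / 2) \<and>
           k1 t = theta_form g \<Gamma> \<phi> c (cmap c (C t)) (\<xi> c (cmap c (C t))) * sqrt (a ^ 4 + b ^ 2) / 2"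
proof (intro ballI)
  fix t c
  assume t: "t \<in> I" and c: "c \<in> charts_at A (C t)"
  define p where "p = cmap c (C t)"
  define T where "T = velocity C c t"
  have "c \<in> A" "p \<in> cran c"
    using c by (auto simp: charts_at_def cran_def p_def)
  then interpret almost_contact_B_metric_form "\<phi> c p" "\<xi> c p" "\<eta> c p" "g c p"
    using assms(1) by (intro almost_contact_B_metric_form_at) (auto simp: F4_manifold_def)
  have T: "g c p T T = 0" "\<eta> c p T = a" "g c p T (\<phi> c p T) = b"
    using assms(2,3) t c by (auto simp: null_curve_def phi_slant_def p_def T_def)
  have frame: "g c p T (N c t) = 1" "g c p (W c t) (W c t) = 1" "g c p T (W c t) = 0"
    using assms(4) t c by (auto simp: general_Frenet_frame_def Let_def p_def T_def)
  obtain P :: "real ^ 3 ^ 3" where P: "det P > 0"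
    "\<And>i. (vector [T, N c t, W c t] :: real ^ 3 ^ 3) $ i =
      (\<Sum>j\<in>UNIV. P $ i $ j *\<^sub>R (vector [T, \<xi> c p, \<phi> c p T] :: real ^ 3 ^ 3) $ j)"
    using assms(5) t c unfolding same_orientation_def p_def T_def by blast
  obtain \<gamma> \<delta> where W: "W c t = \<beta> t *\<^sub>R T + \<gamma> *\<^sub>R \<xi> c p + \<delta> *\<^sub>R \<phi> c p T"
    using assms(6) t c unfolding p_def T_def by blast
  have "nabla_along \<Gamma> C (velocity C) c t = h t *\<^sub>R T + k1 t *\<^sub>R W c t"
    using assms(7) t c by (simp add: general_Frenet_equations_def T_def)
  \<comment> \<open>Rewriting the acceleration by the first Frenet equation yields exactly the
    premises \<open>D_xi\<close> and \<open>D_phi\<close>.\<close>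
  note accel = F4_phi_slant_acceleration[OF assms(1-3) t c, unfolded this, folded p_def T_def]
  show "h t = - \<beta> t * (theta_form g \<Gamma> \<phi> c (cmap c (C t)) (\<xi> c (cmap c (C t))) * sqrt (a ^ 4 + b ^ 2) / 2) \<and>
      k1 t = theta_form g \<Gamma> \<phi> c (cmap c (C t)) (\<xi> c (cmap c (C t))) * sqrt (a ^ 4 + b ^ 2) / 2"
    unfolding p_def[symmetric]
    using slant_Frenet_coefficients[OF T frame P(1) _ _ _ W accel]
      P(2)[of 1] P(2)[of 2] P(2)[of 3] by (simp add: sum_3)
qed

end
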